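(* Let $b\geq 2$ and $k\geq 1$ be integers. If there exists a $k$-oasis base $b$, then there exist infinitely many $k$-oases base $b$.
   Context: For integers $c\geq 0$ and $b\geq 2$, the augmented generalized happy function $S_{[c,b]}:\mathbb{Z}^+\to\mathbb{Z}^+$ is defined by $S_{[c,b]}\left(\sum_{i=0}^n a_i b^i\right)=c+\sum_{i=0}^n a_i^2$, where $0\le a_i\le b-1$, $a_n\neq 0$ (the base $b$ expansion). A positive integer $a$ is a fixed point of $S_{[c,b]}$ if $S_{[c,b]}(a)=a$. For $b\geq 2$ and $k\in\mathbb{Z}^+$, a $k$-oasis base $b$ is a set of $k$ consecutive non-negative integers $c$ such that for each of them $S_{[c,b]}$ has at least one fixed point. *)

theory Defs
  imports Complex_Main "HOL-Library.Log_Nat"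
begin

text \<open>
  The base \<open>b\<close> digits of \<open>x > 0\<close> are \<open>x div b ^ i mod b\<close> for \<open>i < floorlog b x\<close>, where
  \<open>floorlog b x\<close> is the number of base \<open>b\<close> digits of \<open>x\<close>. The function is meant for \<open>b \<ge> 2\<close>
  and \<open>x > 0\<close>; see lemma \<open>happy_expansion\<close> for the description in terms of an arbitrary
  base \<open>b\<close> expansion.
\<close>

definition happy :: "nat \<Rightarrow> nat \<Rightarrow> nat \<Rightarrow> nat" where
  "happy c b x = c + (\<Sum>i<floorlog b x. (x div b ^ i mod b)\<^sup>2)"

definition happy_fixed_point :: "nat \<Rightarrow> nat \<Rightarrow> nat \<Rightarrow> bool" where
  "happy_fixed_point c b a \<longleftrightarrow> 0 < a \<and> happy c b a = a"

definition oasis :: "nat \<Rightarrow> nat \<Rightarrow> nat set \<Rightarrow> bool" where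
  "oasis k b C \<longleftrightarrow>
     (\<exists>m. C = {m..<m + k}) \<and> (\<forall>c\<in>C. \<exists>a. happy_fixed_point c b a)"

lemma expansion_less:
  fixes b :: nat
  assumes "\<And>i. i < n \<Longrightarrow> a i < b"
  shows "(\<Sum>i<n. a i * b ^ i) < b ^ n"
  using assms
proof (induction n)
  case 0
  then show ?case by simp
next
  case (Suc n)
  have "(\<Sum>i<n. a i * b ^ i) < b ^ n" using Suc by simp
  moreover have "Suc (a n) * b ^ n \<le> b * b ^ n"
    using Suc.prems[of n] by (intro mult_right_mono) auto
  ultimately show ?case by simp
qed

lemma expansion_digit:
  fixes b :: nat
  assumes "\<And>i. i < n \<Longrightarrow> a i < b" and "j < n"
  shows "(\<Sum>i<n. a i * b ^ i) div b ^ j mod b = a j"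
  using assms
proof (induction n)
  case 0
  then show ?case by simp
next
  case (Suc n)
  have lt: "(\<Sum>i<n. a i * b ^ i) < b ^ n"
    using Suc.prems by (intro expansion_less) auto
  have b: "b > 0" using Suc.prems(1)[of n] by simp
  show ?case
  proof (cases "j = n")
    case True
    then show ?thesis using lt b Suc.prems(1)[of n] by simp
  next
    case False
    with Suc.prems have j: "j < n" by simp
    then obtain d where d: "n = j + Suc d" using less_imp_Suc_add by auto
    have "(\<Sum>i<Suc n. a i * b ^ i) = (\<Sum>i<n. a i * b ^ i) + (a n * b ^ d * b) * b ^ j"
      by (simp add: d power_add mult_ac)
    then have "(\<Sum>i<Suc n. a i * b ^ i) div b ^ j =
        (\<Sum>i<n. a i * b ^ i) div b ^ j + a n * b ^ d * b"
      using b div_mult_self1[of "b ^ j" "\<Sum>i<n. a i * b ^ i" "a n * b ^ d * b"]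
      by (metis add.commute neq0_conv power_not_zero)
    then show ?thesis using Suc.IH Suc.prems(1) j by simp
  qed
qed

lemma happy_expansion:
  assumes "2 \<le> b" and "\<And>i. i \<le> n \<Longrightarrow> a i < b" and "a n \<noteq> 0"
  shows "happy c b (\<Sum>i\<le>n. a i * b ^ i) = c + (\<Sum>i\<le>n. (a i)\<^sup>2)"
proof -
  let ?x = "\<Sum>i<Suc n. a i * b ^ i"
  have lt: "?x < b ^ Suc n" using assms(2) by (intro expansion_less) auto
  have "b ^ n \<le> a n * b ^ n" using assms(3) by simp
  then have ge: "b ^ n \<le> ?x" by (simp only: sum.lessThan_Suc)
  have "floorlog b ?x = Suc n"
  proof (rule antisym)
    show "floorlog b ?x \<le> Suc n" using lt assms(1) by (intro floorlog_leI) simp_all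
    show "Suc n \<le> floorlog b ?x" using ge assms(1) by (intro floorlog_ge_SucI) simp_all
  qed
  moreover have "?x div b ^ i mod b = a i" if "i < Suc n" for i
    using assms(2) that by (intro expansion_digit) auto
  ultimately have "happy c b ?x = c + (\<Sum>i<Suc n. (a i)\<^sup>2)"
    unfolding happy_def by simp
  then show ?thesis by (simp only: lessThan_Suc_atMost)
qed

end

theory Submission
  imports Defs
begin

text \<open>
  If \<open>a < b ^ n\<close> then \<open>b ^ n + a\<close> has the digits of \<open>a\<close> and a further leading digit 1, so
  a fixed point \<open>a\<close> for \<open>c\<close> gives the fixed point \<open>b ^ n + a\<close> for \<open>c + (b ^ n - 1)\<close>. For
  every large \<open>n\<close>, this translates a whole oasis by \<open>b ^ n - 1\<close>.
\<close>

text \<open>Positions from \<open>floorlog b x\<close> on hold digit 0 and contribute nothing. The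
  range of summation can thus depend on \<open>n\<close> alone, so that \<open>x\<close> and
  \<open>b ^ n + x\<close> are compared position by position.\<close>

lemma happy_eq_sum_padded:
  assumes "2 \<le> b" and "x < b ^ n"
  shows "happy c b x = c + (\<Sum>i<n. (x div b ^ i mod b)\<^sup>2)"
proof -
  have le: "floorlog b x \<le> n"
    using assms by (intro floorlog_leI) simp_all
  have "x div b ^ i = 0" if "floorlog b x \<le> i" for i
    using floorlog_leD[OF that] assms(1) by simp
  then have "(\<Sum>i<floorlog b x. (x div b ^ i mod b)\<^sup>2) = (\<Sum>i<n. (x div b ^ i mod b)\<^sup>2)"
    using le by (intro sum.mono_neutral_left) auto
  then show ?thesis by (simp add: happy_def)
qed

lemma happy_power_add:
  assumes "2 \<le> b" and "x < b ^ n"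
  shows "happy c b (b ^ n + x) = Suc (happy c b x)"
proof -
  have "2 * b ^ n \<le> b * b ^ n"
    using assms(1) by (intro mult_right_mono) simp_all
  then have lt: "b ^ n + x < b ^ Suc n"
    using assms(2) unfolding power_Suc by linarith
  have "(b ^ n + x) div b ^ i mod b = x div b ^ i mod b" if "i < n" for i
  proof -
    \<comment> \<open>Since \<open>i < n\<close>, dividing \<open>b ^ n\<close> by
      \<open>b ^ i\<close> leaves a multiple of \<open>b\<close>, which does not affect digit
      \<open>i\<close>.\<close>
    obtain d where d: "n = i + Suc d" using \<open>i < n\<close> less_imp_Suc_add by auto
    have "b ^ n + x = x + b ^ i * (b * b ^ d)"
      by (simp add: d power_add)
    then have "(b ^ n + x) div b ^ i = b * b ^ d + x div b ^ i"
      using assms(1) by simp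
    then show ?thesis by simp
  qed
  moreover have "(b ^ n + x) div b ^ n mod b = 1"
    using assms by simp
  ultimately show ?thesis
    using assms by (simp add: happy_eq_sum_padded[OF assms(1) lt] happy_eq_sum_padded)
qed

lemma happy_fixed_point_power_add:
  assumes "2 \<le> b" and "a < b ^ n" and "happy_fixed_point c b a"
  shows "happy_fixed_point (c + (b ^ n - 1)) b (b ^ n + a)"
proof -
  have "happy (c + (b ^ n - 1)) b (b ^ n + a) = happy c b (b ^ n + a) + (b ^ n - 1)"
    by (simp add: happy_def)
  \<comment> \<open>The new leading digit contributes 1, which \<open>b ^ n - 1\<close> completes to
    \<open>b ^ n\<close>; the subtraction is exact as \<open>b ^ n\<close> is positive.\<close>
  also have "\<dots> = b ^ n + a"
    using assms by (simp add: happy_power_add happy_fixed_point_def)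
  finally show ?thesis
    using assms(3) by (simp add: happy_fixed_point_def)
qed

lemma oasis_translate:
  assumes "2 \<le> b" and "oasis k b {m..<m + k}"
  shows "\<exists>N. \<forall>n\<ge>N. oasis k b {m + (b ^ n - 1)..<m + (b ^ n - 1) + k}"
proof -
  have "\<forall>c\<in>{m..<m + k}. \<exists>a. happy_fixed_point c b a"
    using assms(2) unfolding oasis_def by blast
  then obtain f where f: "\<And>c. c \<in> {m..<m + k} \<Longrightarrow> happy_fixed_point c b (f c)"
    by metis
  \<comment> \<open>One exponent has to serve all \<open>c\<close> of the oasis, so \<open>N\<close>
    bounds the finitely many chosen fixed points; then \<open>f c \<le> n < b ^ n\<close>. The
    inserted 0 keeps \<open>Max\<close> meaningful for an empty interval.\<close>
  define N where "N = Max (insert 0 (f ` {m..<m + k}))"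
  have less: "f c < b ^ n" if "c \<in> {m..<m + k}" and "N \<le> n" for c n
  proof -
    have "f c \<le> N" unfolding N_def using that by (intro Max_ge) auto
    also have "\<dots> \<le> n" by fact
    also have "n < b ^ n" using assms(1) by (intro power_gt_expt) simp
    finally show ?thesis .
  qed
  have "oasis k b {m + (b ^ n - 1)..<m + (b ^ n - 1) + k}" if "N \<le> n" for n
    unfolding oasis_def
  proof (intro conjI ballI)
    show "\<exists>m'. {m + (b ^ n - 1)..<m + (b ^ n - 1) + k} = {m'..<m' + k}" by blast
  next
    fix c assume "c \<in> {m + (b ^ n - 1)..<m + (b ^ n - 1) + k}"
    then have "c - (b ^ n - 1) \<in> {m..<m + k}" and "c = c - (b ^ n - 1) + (b ^ n - 1)"
      by auto
    then show "\<exists>a. happy_fixed_point c b a"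
      using happy_fixed_point_power_add[OF assms(1) less f] that by metis
  qed
  then show ?thesis by blast
qed

theorem theorem4:
  fixes b k :: nat
  assumes "2 \<le> b" and "1 \<le> k"
    and "\<exists>C. oasis k b C"
  shows "infinite {C. oasis k b C}"
proof -
  obtain m where "oasis k b {m..<m + k}"
    using assms(3) unfolding oasis_def by blast
  then obtain N where N: "\<And>n. N \<le> n \<Longrightarrow> oasis k b {m + (b ^ n - 1)..<m + (b ^ n - 1) + k}"
    using oasis_translate[OF assms(1)] by blast
  let ?C = "\<lambda>n. {m + (b ^ n - 1)..<m + (b ^ n - 1) + k}"
  have "inj_on ?C {N..}"
  proof (rule inj_onI)
    fix i j assume "?C i = ?C j"
    \<comment> \<open>As \<open>k \<ge> 1\<close>, the intervals are nonempty and determine their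
      left endpoints.\<close>
    then have "m + (b ^ i - 1) = m + (b ^ j - 1)"
      using assms(2) by (intro atLeastLessThan_inj(1)) auto
    \<comment> \<open>Positivity rules out truncation in \<open>b ^ i - 1\<close> and
      \<open>b ^ j - 1\<close>, so the 1 cancels.\<close>
    moreover have "0 < b ^ i" and "0 < b ^ j" using assms(1) by simp_all
    ultimately have "b ^ i = b ^ j" by linarith
    then show "i = j" using assms(1) by simp
  qed
  then have "infinite (?C ` {N..})"
    using finite_imageD infinite_Ici by blast
  moreover have "?C ` {N..} \<subseteq> {C. oasis k b C}" using N by auto
  ultimately show ?thesis by (rule infinite_super[rotated])
qed

end
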